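(* Let $\nu\in\mathcal{P}_+$, i.e. let $\nu$ be a probability measure on the Borel subsets of $[0,\infty)$. For each natural number $n\ge2$ and $\alpha>0$ we have $$\lambda_{0,n,\alpha}(\nu)(0,x)=\Phi_\nu^n\!\left(\frac1x\right)+\alpha^{-1}x\,\frac{d}{dx}\left(\Phi_\nu^n\!\left(\frac1x\right)\right),$$ or equivalently $$\lambda_{0,n,\alpha}(\nu)(0,x)=\frac{d}{ds}\Bigl(s\,\Phi_\nu^n\bigl(s^{-1/\alpha}\bigr)\Bigr)\Big|_{s=x^\alpha},$$ where $$\Phi_\nu(t)=h(T_t\nu)=\int_0^\infty\bigl(1-(xt)^\alpha\bigr)_+\,\nu(dx)$$ is the homomorphism of the unit step variable $\Delta X_1\sim\nu$.
   Context: For $a\ge0$, $T_a\lambda$ denotes the law of $a\theta$ for $\theta\sim\lambda$, and $(y)_+=\max(y,0)$. $\pi_{2\alpha}$ is the Pareto distribution with density $\frac{2\alpha}{x^{2\alpha+1}}\mathbf{1}_{(1,\infty)}(x)$. The Kendall convolution $\triangle_\alpha$ is the commutative, associative binary operation on $\mathcal{P}_+$ determined by $$\delta_a\triangle_\alpha\delta_b=\Bigl(1-\frac{a^\alpha}{b^\alpha}\Bigr)\delta_b+\frac{a^\alpha}{b^\alpha}T_b\pi_{2\alpha}\quad(0\le a\le b,\ b>0),\qquad \delta_0\triangle_\alpha\delta_0=\delta_0,$$ and $(\lambda_1\triangle_\alpha\lambda_2)(A)=\int\!\int(\delta_x\triangle_\alpha\delta_y)(A)\,\lambda_1(dx)\lambda_2(dy)$.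 Its homomorphism is $h(\lambda)=\int_0^\infty h(\delta_x)\,\lambda(dx)$ with $h(\delta_t)=(1-t^\alpha)_+$. $\lambda_{0,n,\alpha}(\nu)=\nu^{\triangle_\alpha n}$ is the $n$-th power of $\nu$ with respect to $\triangle_\alpha$; it is the law of the $n$-th position $X_n$ of the random walk under $\triangle_\alpha$ started at $X_0=0$ with i.i.d. steps $\Delta X_i\sim\nu$. $\lambda_{0,n,\alpha}(\nu)(0,x)$ is the value of this measure on the interval $(0,x)$. $\Phi_\nu^n(t)$ means $(\Phi_\nu(t))^n$.
   Formalization: For x>0 the formulas are proved for the mass of [0,x), which is that of (0,x) plus ν({0})^n (ν=δ_0 refutes (0,x)); d/dx and d/ds are left derivatives, and ordinary derivatives if x is not an atom of λ_{0,n,α}(ν), since at an atom they may fail to exist. *)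

theory Defs
  imports "HOL-Probability.Probability"
begin

abbreviation borel_nonneg :: "real measure" where
  "borel_nonneg \<equiv> restrict_space borel {0..}"

definition P_plus :: "real measure set" where
  "P_plus = space (prob_algebra borel_nonneg)"

definition rescale :: "real \<Rightarrow> real measure \<Rightarrow> real measure" where
  "rescale a \<mu> = distr \<mu> borel_nonneg (\<lambda>\<theta>. a * \<theta>)"

definition pareto :: "real \<Rightarrow> real measure" where
  "pareto \<beta> = density (restrict_space lborel {0..})
     (\<lambda>x. ennreal (\<beta> / x powr (\<beta> + 1) * indicator {1<..} x))"

(* The convolution of the Dirac measures at x and y; commutativity reduces it to the case
   a = min x y, b = max x y of the defining formula. *)
definition kendall_kernel :: "real \<Rightarrow> real \<Rightarrow> real \<Rightarrow> real measure" where
  "kendall_kernel \<alpha> x y =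
     (let a = min x y; b = max x y in
        if b = 0 then return borel_nonneg 0
        else measure_of {0..} (sets borel_nonneg)
          (\<lambda>A. ennreal (1 - a powr \<alpha> / b powr \<alpha>) * emeasure (return borel_nonneg b) A
             + ennreal (a powr \<alpha> / b powr \<alpha>) * emeasure (rescale b (pareto (2 * \<alpha>))) A))"

definition kendall_conv :: "real \<Rightarrow> real measure \<Rightarrow> real measure \<Rightarrow> real measure" where
  "kendall_conv \<alpha> \<mu> \<nu> = \<mu> \<bind> (\<lambda>x. \<nu> \<bind> (\<lambda>y. kendall_kernel \<alpha> x y))"

primrec kendall_power :: "real \<Rightarrow> real measure \<Rightarrow> nat \<Rightarrow> real measure" where
  "kendall_power \<alpha> \<nu> 0 = return borel_nonneg 0"
| "kendall_power \<alpha> \<nu> (Suc n) = kendall_conv \<alpha> (kendall_power \<alpha> \<nu> n) \<nu>"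

(* The power has mass (measure \<nu> {0}) ^ n at 0, so [0, x) and (0, x) carry different masses when
   \<nu> has an atom at 0.  An atom x of the power is a point where u \<mapsto> Phi \<alpha> \<nu> (1 / u) ^ n has
   distinct one-sided derivatives; the left one corresponds to the mass of [0, x), the right one
   to that of [0, x]. *)

definition kendall_hom :: "real \<Rightarrow> real measure \<Rightarrow> real" where
  "kendall_hom \<alpha> \<mu> = (LINT t|\<mu>. max (1 - t powr \<alpha>) 0)"

definition Phi :: "real \<Rightarrow> real measure \<Rightarrow> real \<Rightarrow> real" where
  "Phi \<alpha> \<nu> t = kendall_hom \<alpha> (rescale t \<nu>)"

lemma P_plusD:
  assumes "\<mu> \<in> P_plus"
  shows "prob_space \<mu>" "sets \<mu> = sets borel_nonneg" "space \<mu> = {0..}"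
  using assms sets_eq_imp_space_eq[of \<mu> borel_nonneg]
  by (auto simp: P_plus_def space_prob_algebra space_restrict_space)

lemma Phi_eq_integral:
  assumes "\<nu> \<in> P_plus" "t \<ge> 0"
  shows "Phi \<alpha> \<nu> t = (LINT x|\<nu>. max (1 - (x * t) powr \<alpha>) 0)"
proof -
  have assms_sets: "sets \<nu> = sets borel_nonneg"
    using assms by (simp add: P_plusD)
  have m: "(\<lambda>\<theta>. t * \<theta>) \<in> measurable \<nu> borel_nonneg"
    using assms
    by (subst measurable_cong_sets[OF assms_sets refl],
        intro measurable_restrict_space2 measurable_restrict_space1) (auto simp: space_restrict_space)
  have m2: "(\<lambda>t. max (1 - t powr \<alpha>) 0) \<in> borel_measurable borel_nonneg"
    by (intro measurable_restrict_space1) measurable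
  show ?thesis
    unfolding Phi_def kendall_hom_def rescale_def
    by (subst integral_distr[OF m m2]) (simp add: mult.commute)
qed

lemma sets_pareto [measurable_cong]: "sets (pareto \<beta>) = sets borel_nonneg"
  by (simp add: pareto_def sets_restrict_space)

lemma space_pareto: "space (pareto \<beta>) = {0..}"
  by (simp add: pareto_def space_restrict_space)

lemma prob_space_pareto:
  assumes "\<beta> > 0"
  shows "prob_space (pareto \<beta>)"
proof
  have "emeasure (pareto \<beta>) (space (pareto \<beta>)) =
      (\<integral>\<^sup>+x. ennreal (\<beta> / x powr (\<beta> + 1) * indicator {1<..} x) \<partial>restrict_space lborel {0..})"
    unfolding pareto_def
    by (subst emeasure_density)
       (auto intro!: nn_integral_cong measurable_restrict_space1 simp: space_restrict_space sets_restrict_space)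
  also have "\<dots> = (\<integral>\<^sup>+x. ennreal (\<beta> / x powr (\<beta> + 1) * indicator {1<..} x) * indicator {0..} x \<partial>lborel)"
    by (subst nn_integral_restrict_space) auto
  also have "\<dots> = (\<integral>\<^sup>+x. ennreal (\<beta> * x powr (- \<beta> - 1)) * indicator {1..} x \<partial>lborel)"
    by (intro nn_integral_cong_AE, rule AE_mp[OF AE_lborel_singleton[of 1]])
       (auto simp: indicator_def powr_minus_divide divide_simps powr_diff powr_add powr_minus)
  also have "\<dots> = ennreal (0 - (- (1 powr (- \<beta>))))"
  proof (rule nn_integral_FTC_atLeast)
    show "((\<lambda>x. - (x powr (- \<beta>))) has_real_derivative \<beta> * x powr (- \<beta> - 1)) (at x)" if "1 \<le> x" for x
      using that by (auto intro!: derivative_eq_intros)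
    show "((\<lambda>x. - (x powr (- \<beta>))) \<longlongrightarrow> 0) at_top"
      using tendsto_minus[OF tendsto_neg_powr[of "-\<beta>" "\<lambda>x. x" at_top]] assms
      by (simp add: filterlim_ident)
  qed (use assms in auto)
  finally show "emeasure (pareto \<beta>) (space (pareto \<beta>)) = 1" by simp
qed

lemma rescale_pareto_measurable:
  assumes "b \<ge> 0"
  shows "(\<lambda>\<theta>. b * \<theta>) \<in> measurable (pareto \<beta>) borel_nonneg"
proof -
  have "(\<lambda>\<theta>. b * \<theta>) \<in> measurable borel_nonneg borel_nonneg"
    using assms by (intro measurable_restrict_space2 measurable_restrict_space1)
      (auto simp: space_restrict_space)
  thus ?thesis
    by (simp cong: measurable_cong_sets add: sets_pareto)
qed

lemma sets_kendall_kernel: "sets (kendall_kernel \<alpha> x y) = sets borel_nonneg"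
proof -
  have "sets borel_nonneg \<subseteq> Pow {0..}" "sigma_sets {0..} (sets borel_nonneg) = sets borel_nonneg"
    using sets.space_closed[of borel_nonneg] sets.sigma_sets_eq[of borel_nonneg]
    by (simp_all add: space_restrict_space)
  thus ?thesis
    by (simp add: kendall_kernel_def Let_def sets_measure_of)
qed

lemma emeasure_kendall_kernel:
  assumes "0 \<le> a" "a \<le> b" "0 < b" "A \<in> sets borel_nonneg"
  shows "emeasure (kendall_kernel \<alpha> a b) A =
     ennreal (1 - a powr \<alpha> / b powr \<alpha>) * emeasure (return borel_nonneg b) A
     + ennreal (a powr \<alpha> / b powr \<alpha>) * emeasure (rescale b (pareto (2 * \<alpha>))) A"
proof -
  let ?p = "a powr \<alpha> / b powr \<alpha>"
  let ?f = "\<lambda>A. ennreal (1 - ?p) * emeasure (return borel_nonneg b) A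
       + ennreal ?p * emeasure (rescale b (pareto (2 * \<alpha>))) A"
  have ca: "countably_additive (sets borel_nonneg) ?f"
  proof (rule countably_additiveI)
    fix F :: "nat \<Rightarrow> real set"
    assume F: "range F \<subseteq> sets borel_nonneg" "disjoint_family F"
    have 1: "(\<Sum>i. emeasure (return borel_nonneg b) (F i)) = emeasure (return borel_nonneg b) (\<Union>i. F i)"
      using F by (intro suminf_emeasure) auto
    have 2: "(\<Sum>i. emeasure (rescale b (pareto (2 * \<alpha>))) (F i)) = emeasure (rescale b (pareto (2 * \<alpha>))) (\<Union>i. F i)"
      using F by (intro suminf_emeasure) (auto simp: rescale_def)
    show "(\<Sum>i. ?f (F i)) = ?f (\<Union>i. F i)"
      by (simp add: 1 2 flip: suminf_add)
  qed
  have sa: "sigma_algebra {0..} (sets borel_nonneg)"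
    using sets.sigma_algebra_axioms[of borel_nonneg] by (simp add: space_restrict_space)
  have mm: "min a b = a" "max a b = b" "b \<noteq> 0"
    using assms by auto
  have K: "kendall_kernel \<alpha> a b = measure_of {0..} (sets borel_nonneg) ?f"
    unfolding kendall_kernel_def Let_def mm using mm by simp
  show ?thesis
    unfolding K
    by (rule emeasure_measure_of_sigma[OF sa _ ca assms(4)]) (simp add: positive_def)
qed

lemma kendall_kernel_0: "kendall_kernel \<alpha> 0 0 = return borel_nonneg 0"
  by (simp add: kendall_kernel_def)

lemma kendall_kernel_commute: "kendall_kernel \<alpha> x y = kendall_kernel \<alpha> y x"
  by (simp add: kendall_kernel_def min.commute max.commute)

lemma emeasure_rescale_pareto:
  assumes "b \<ge> 0" "A \<in> sets borel_nonneg"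
  shows "emeasure (rescale b (pareto \<beta>)) A = (\<integral>\<^sup>+\<theta>. indicator A (b * \<theta>) \<partial>pareto \<beta>)"
proof -
  have "emeasure (rescale b (pareto \<beta>)) A = (\<integral>\<^sup>+\<theta>. indicator A \<theta> \<partial>rescale b (pareto \<beta>))"
    using assms by (simp add: rescale_def)
  also have "\<dots> = (\<integral>\<^sup>+\<theta>. indicator A (b * \<theta>) \<partial>pareto \<beta>)"
    unfolding rescale_def using assms
    by (intro nn_integral_distr rescale_pareto_measurable) auto
  finally show ?thesis .
qed

lemma prob_space_kendall_kernel:
  assumes "\<alpha> > 0" "x \<ge> 0" "y \<ge> 0"
  shows "prob_space (kendall_kernel \<alpha> x y)"
proof -
  have *: "prob_space (kendall_kernel \<alpha> a b)" if ab: "0 \<le> a" "a \<le> b" for a b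
  proof (cases "b = 0")
    case True
    thus ?thesis using ab
      by (auto simp: kendall_kernel_0 space_restrict_space intro!: prob_space_return)
  next
    case False
    have sp: "space (kendall_kernel \<alpha> a b) = {0..}"
      using sets_eq_imp_space_eq[OF sets_kendall_kernel[of \<alpha> a b]] by (simp add: space_restrict_space)
    have A: "{0..} \<in> sets borel_nonneg"
      using sets.top[of borel_nonneg] by (simp add: space_restrict_space)
    have r: "prob_space (rescale b (pareto (2 * \<alpha>)))"
      unfolding rescale_def using assms ab
      by (intro prob_space.prob_space_distr prob_space_pareto rescale_pareto_measurable) auto
    have r1: "emeasure (rescale b (pareto (2 * \<alpha>))) {0..} = 1"
      using prob_space.emeasure_space_1[OF r] by (simp add: rescale_def space_restrict_space)
    have p: "0 \<le> a powr \<alpha> / b powr \<alpha>" "a powr \<alpha> / b powr \<alpha> \<le> 1"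
      using ab False assms by (auto simp: divide_simps powr_mono2)
    have "emeasure (kendall_kernel \<alpha> a b) {0..} = 1"
      using ab False p A
      by (subst emeasure_kendall_kernel) (auto simp: r1 simp flip: ennreal_plus)
    thus ?thesis by (intro prob_spaceI) (simp add: sp)
  qed
  show ?thesis
    using *[of x y] *[of y x] assms by (cases "x \<le> y") (auto simp: kendall_kernel_commute[of \<alpha> x y])
qed

lemma measurable_kendall_kernel:
  assumes "\<alpha> > 0"
  shows "(\<lambda>(x, y). kendall_kernel \<alpha> x y) \<in> measurable (borel_nonneg \<Otimes>\<^sub>M borel_nonneg) (prob_algebra borel_nonneg)"
proof (rule measurable_prob_algebraI)
  let ?N = "borel_nonneg \<Otimes>\<^sub>M borel_nonneg"
  show "prob_space (case z of (x, y) \<Rightarrow> kendall_kernel \<alpha> x y)" if "z \<in> space ?N" for z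
    using that assms
    by (auto simp: space_pair_measure space_restrict_space intro: prob_space_kendall_kernel)
  show "(\<lambda>(x, y). kendall_kernel \<alpha> x y) \<in> measurable ?N (subprob_algebra borel_nonneg)"
  proof (rule measurable_subprob_algebra)
    show "subprob_space (case z of (x, y) \<Rightarrow> kendall_kernel \<alpha> x y)" if "z \<in> space ?N" for z
      using that assms
      by (auto simp: space_pair_measure space_restrict_space
          intro!: prob_space_imp_subprob_space prob_space_kendall_kernel)
    show "sets (case z of (x, y) \<Rightarrow> kendall_kernel \<alpha> x y) = sets borel_nonneg" for z
      by (auto simp: sets_kendall_kernel split: prod.split)
    fix A :: "real set" assume A: "A \<in> sets borel_nonneg"
    interpret P: prob_space "pareto (2 * \<alpha>)"
      using assms by (intro prob_space_pareto) auto
    have A': "A \<in> sets borel"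
      using A by (auto simp: sets_restrict_space)
    define p where "p = (\<lambda>x y::real. min x y powr \<alpha> / max x y powr \<alpha>)"
    define f where "f = (\<lambda>x y. if max x y = 0 then indicator A (0::real)
       else ennreal (1 - p x y) * indicator A (max x y)
         + ennreal (p x y) * (\<integral>\<^sup>+\<theta>. indicator A (max x y * \<theta>) \<partial>pareto (2 * \<alpha>)))"
    have f: "emeasure (kendall_kernel \<alpha> x y) A = f x y" if "x \<ge> 0" "y \<ge> 0" for x y
    proof -
      have *: "emeasure (kendall_kernel \<alpha> a b) A = f a b" if "0 \<le> a" "a \<le> b" for a b
        using that A
        by (cases "b = 0")
           (auto simp: kendall_kernel_0 emeasure_kendall_kernel f_def p_def emeasure_rescale_pareto
              max_absorb2 min_absorb1)
      have "f y x = f x y"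
        by (simp add: f_def p_def min.commute max.commute)
      thus ?thesis
        using *[of x y] *[of y x] that by (cases "x \<le> y") (auto simp: kendall_kernel_commute[of \<alpha> x y])
    qed
    have fst_m [measurable]: "fst \<in> borel_measurable ?N" "snd \<in> borel_measurable ?N"
      using measurable_compose[OF measurable_fst measurable_restrict_space1[OF measurable_ident]]
            measurable_compose[OF measurable_snd measurable_restrict_space1[OF measurable_ident]]
      by (auto simp: comp_def)
    have [measurable]: "(\<lambda>z. \<integral>\<^sup>+\<theta>. indicator A (max (fst z) (snd z) * \<theta>) \<partial>pareto (2 * \<alpha>)) \<in> borel_measurable ?N"
    proof -
      have "(\<lambda>\<theta>. \<theta>) \<in> borel_measurable (pareto (2 * \<alpha>))"
        by (simp cong: measurable_cong_sets add: sets_pareto measurable_restrict_space1)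
      hence [measurable]: "(\<lambda>w. snd w) \<in> borel_measurable (?N \<Otimes>\<^sub>M pareto (2 * \<alpha>))"
        by (rule measurable_compose[OF measurable_snd])
      have [measurable]: "(\<lambda>w. fst (fst w)) \<in> borel_measurable (?N \<Otimes>\<^sub>M pareto (2 * \<alpha>))"
        "(\<lambda>w. snd (fst w)) \<in> borel_measurable (?N \<Otimes>\<^sub>M pareto (2 * \<alpha>))"
        by (rule measurable_compose[OF measurable_fst fst_m(1)],
            rule measurable_compose[OF measurable_fst fst_m(2)])
      note A'[measurable]
      have "(\<lambda>w. indicator A (max (fst (fst w)) (snd (fst w)) * snd w) :: ennreal)
          \<in> borel_measurable (?N \<Otimes>\<^sub>M pareto (2 * \<alpha>))"
        by measurable
      thus ?thesis
        by (intro P.borel_measurable_nn_integral) (simp add: case_prod_beta)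
    qed
    note A'[measurable]
    have "(\<lambda>z. f (fst z) (snd z)) \<in> borel_measurable ?N"
      unfolding f_def p_def by measurable
    thus "(\<lambda>z. emeasure (case z of (x, y) \<Rightarrow> kendall_kernel \<alpha> x y) A) \<in> borel_measurable ?N"
      by (rule measurable_cong[THEN iffD1, rotated])
         (auto simp: space_pair_measure space_restrict_space f)
  qed
qed

lemma kendall_conv_P_plus:
  assumes "\<alpha> > 0" "\<mu> \<in> P_plus" "\<nu> \<in> P_plus"
  shows "kendall_conv \<alpha> \<mu> \<nu> \<in> P_plus"
    and "A \<in> sets borel_nonneg \<Longrightarrow> emeasure (kendall_conv \<alpha> \<mu> \<nu>) A =
      (\<integral>\<^sup>+x. \<integral>\<^sup>+y. emeasure (kendall_kernel \<alpha> x y) A \<partial>\<nu> \<partial>\<mu>)"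
proof -
  have inner: "(\<lambda>x. \<nu> \<bind> (\<lambda>y. kendall_kernel \<alpha> x y)) \<in> measurable borel_nonneg (prob_algebra borel_nonneg)"
    using assms measurable_kendall_kernel[of \<alpha>]
    by (intro measurable_bind_prob_space2[where N = borel_nonneg] measurable_const) (auto simp: P_plus_def)
  have y: "(\<lambda>y. kendall_kernel \<alpha> x y) \<in> measurable borel_nonneg (prob_algebra borel_nonneg)" if "x \<ge> 0" for x
    using measurable_compose[OF measurable_Pair1'[of x borel_nonneg borel_nonneg] measurable_kendall_kernel[OF assms(1)]] that
    by (simp add: space_restrict_space)
  have sets: "sets \<mu> = sets borel_nonneg" "sets \<nu> = sets borel_nonneg"
    using assms by (auto simp: P_plusD)
  have inner': "(\<lambda>x. \<nu> \<bind> (\<lambda>y. kendall_kernel \<alpha> x y)) \<in> measurable \<mu> (subprob_algebra borel_nonneg)"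
    using measurable_prob_algebraD[OF inner] by (simp cong: measurable_cong_sets add: sets)
  show "kendall_conv \<alpha> \<mu> \<nu> \<in> P_plus"
  proof -
    have "prob_space (kendall_conv \<alpha> \<mu> \<nu>)"
      unfolding kendall_conv_def using assms inner' measurable_space[OF inner]
      by (intro prob_space.prob_space_bind[where S = borel_nonneg])
         (auto simp: P_plusD space_prob_algebra space_restrict_space)
    moreover have "sets (kendall_conv \<alpha> \<mu> \<nu>) = sets borel_nonneg"
      unfolding kendall_conv_def using assms sets_kernel[OF inner']
      by (intro sets_bind) (simp_all add: P_plusD sets_kendall_kernel)
    ultimately show ?thesis by (simp add: P_plus_def space_prob_algebra)
  qed
  assume A: "A \<in> sets borel_nonneg"
  have "emeasure (kendall_conv \<alpha> \<mu> \<nu>) A = (\<integral>\<^sup>+x. emeasure (\<nu> \<bind> (\<lambda>y. kendall_kernel \<alpha> x y)) A \<partial>\<mu>)"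
    unfolding kendall_conv_def using A inner' assms
    by (intro emeasure_bind[where N = borel_nonneg]) (auto simp: P_plusD)
  also have "\<dots> = (\<integral>\<^sup>+x. \<integral>\<^sup>+y. emeasure (kendall_kernel \<alpha> x y) A \<partial>\<nu> \<partial>\<mu>)"
  proof (rule nn_integral_cong)
    fix x assume "x \<in> space \<mu>"
    hence "x \<ge> 0" using assms by (simp add: P_plusD)
    from measurable_prob_algebraD[OF y[OF this]]
    show "emeasure (\<nu> \<bind> (\<lambda>y. kendall_kernel \<alpha> x y)) A = (\<integral>\<^sup>+y. emeasure (kendall_kernel \<alpha> x y) A \<partial>\<nu>)"
      using A assms
      by (intro emeasure_bind[where N = borel_nonneg]) (auto simp: P_plusD cong: measurable_cong_sets)
  qed
  finally show "emeasure (kendall_conv \<alpha> \<mu> \<nu>) A =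
      (\<integral>\<^sup>+x. \<integral>\<^sup>+y. emeasure (kendall_kernel \<alpha> x y) A \<partial>\<nu> \<partial>\<mu>)" .
qed

lemma kendall_power_P_plus:
  assumes "\<alpha> > 0" "\<nu> \<in> P_plus"
  shows "kendall_power \<alpha> \<nu> n \<in> P_plus"
proof (induction n)
  case 0
  show ?case
    by (auto simp: P_plus_def space_prob_algebra space_restrict_space intro!: prob_space_return)
next
  case (Suc n)
  thus ?case using assms by (simp add: kendall_conv_P_plus)
qed

end

theory Submission
  imports Defs
begin

text \<open>
  The proof has two independent ingredients.

  The first is that \<open>Phi\<close> turns the Kendall convolution into a product. By bilinearity it suffices to
  look at point masses at \<open>a \<le> b\<close>, that is, to integrate \<open>max (1 - (z * t) powr \<alpha>) 0\<close> against the kernel.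
  The Pareto part of the kernel contributes the square of \<open>max (1 - c) 0\<close> with \<open>c = (b * t) powr \<alpha>\<close>
  (lemma \<open>nn_integral_pareto_truncated_power\<close>), and the mixture of this square with the value at the
  atom \<open>b\<close> factors (lemma \<open>nn_integral_kendall_kernel\<close>). Hence \<open>Phi\<close> of the \<open>n\<close>-th Kendall power is
  the \<open>n\<close>-th power of \<open>Phi\<close> (lemma \<open>Phi_kendall_power\<close>). Letting its argument tend to infinity gives
  the mass of the power at the origin.

  The second recovers a measure \<open>\<mu>\<close> from its \<open>Phi\<close>. With \<open>s = x powr \<alpha>\<close>, the function
  \<open>s * Phi \<alpha> \<mu> (1 / x)\<close> is the integral of \<open>max (s - y powr \<alpha>) 0\<close> over \<open>\<mu>(dy)\<close>. As a function of \<open>s\<close>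
  this is a primitive of the distribution function of the image of \<open>\<mu>\<close> under \<open>y \<mapsto> y powr \<alpha>\<close>, so its
  left derivative is the mass of \<open>{0..<x}\<close> and its right derivative that of \<open>{0..x}\<close>
  (lemma \<open>scaled_Phi_one_sided_derivatives\<close>). They agree if \<open>x\<close> is not an atom. Applied to the
  Kendall power this is the second form of the formula; the first one results from the
  substitution \<open>s = u powr \<alpha>\<close> and the quotient rule.
\<close>

section \<open>A Pareto integral\<close>

text \<open>
  The Kendall kernel is given by the values of a mixture on sets; this turns the mixture formula
  into one for integrals of functions.
\<close>

lemma nn_integral_emeasure_linear_combination:
  fixes c d :: ennreal
  assumes f: "f \<in> borel_measurable K"
    and sets: "sets M = sets K" "sets N = sets K"
    and K: "\<And>A. A \<in> sets K \<Longrightarrow> emeasure K A = c * emeasure M A + d * emeasure N A"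
  shows "(\<integral>\<^sup>+z. f z \<partial>K) = c * (\<integral>\<^sup>+z. f z \<partial>M) + d * (\<integral>\<^sup>+z. f z \<partial>N)"
  using f
proof (induction rule: borel_measurable_induct)
  case (cong f g)
  have "space M = space K" "space N = space K"
    using sets by (auto dest: sets_eq_imp_space_eq)
  hence "integral\<^sup>N L f = integral\<^sup>N L g" if "L \<in> {K, M, N}" for L
    using that cong by (intro nn_integral_cong) auto
  thus ?case using cong by simp
next
  case (set A)
  thus ?case using K sets by simp
next
  case (mult u e)
  have [measurable]: "u \<in> borel_measurable M" "u \<in> borel_measurable N"
    using mult sets by (simp_all cong: measurable_cong_sets)
  show ?case using mult
    by (simp add: nn_integral_cmult) (simp add: algebra_simps)
next
  case (add u v)
  have [measurable]: "u \<in> borel_measurable M" "u \<in> borel_measurable N"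
      "v \<in> borel_measurable M" "v \<in> borel_measurable N"
    using add sets by (simp_all cong: measurable_cong_sets)
  show ?case using add
    by (simp add: nn_integral_add) (simp add: algebra_simps)
next
  case (seq U)
  have meas: "U i \<in> borel_measurable M" "U i \<in> borel_measurable N" for i
    using seq sets by (simp_all cong: measurable_cong_sets)
  have inc: "incseq (\<lambda>i. c * integral\<^sup>N M (U i))" "incseq (\<lambda>i. d * integral\<^sup>N N (U i))"
    using \<open>incseq U\<close>
    by (auto intro!: incseq_SucI mult_left_mono nn_integral_mono simp: incseq_Suc_iff le_fun_def)
  have "(\<integral>\<^sup>+z. (SUP i. U i) z \<partial>K) = (SUP i. c * integral\<^sup>N M (U i) + d * integral\<^sup>N N (U i))"
    using seq by (simp add: nn_integral_monotone_convergence_SUP image_comp)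
  also have "\<dots> = (SUP i. c * integral\<^sup>N M (U i)) + (SUP i. d * integral\<^sup>N N (U i))"
    by (rule ennreal_SUP_add[OF inc])
  also have "\<dots> = c * (\<integral>\<^sup>+z. (SUP i. U i) z \<partial>M) + d * (\<integral>\<^sup>+z. (SUP i. U i) z \<partial>N)"
    using seq meas
    by (simp add: nn_integral_monotone_convergence_SUP image_comp SUP_mult_left_ennreal)
  finally show ?case .
qed

lemma nn_integral_pareto:
  assumes [measurable]: "f \<in> borel_measurable borel"
  shows "(\<integral>\<^sup>+\<theta>. f \<theta> \<partial>pareto \<beta>) =
    (\<integral>\<^sup>+\<theta>. ennreal (\<beta> / \<theta> powr (\<beta> + 1)) * f \<theta> * indicator {1<..} \<theta> \<partial>lborel)"
proof -
  have "(\<integral>\<^sup>+\<theta>. f \<theta> \<partial>pareto \<beta>) =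
      (\<integral>\<^sup>+\<theta>. ennreal (\<beta> / \<theta> powr (\<beta> + 1) * indicator {1<..} \<theta>) * f \<theta> \<partial>restrict_space lborel {0..})"
    unfolding pareto_def
    by (intro nn_integral_density measurable_restrict_space1) auto
  also have "\<dots> = (\<integral>\<^sup>+\<theta>. ennreal (\<beta> / \<theta> powr (\<beta> + 1) * indicator {1<..} \<theta>) * f \<theta>
      * indicator {0..} \<theta> \<partial>lborel)"
    by (subst nn_integral_restrict_space) auto
  also have "\<dots> = (\<integral>\<^sup>+\<theta>. ennreal (\<beta> / \<theta> powr (\<beta> + 1)) * f \<theta> * indicator {1<..} \<theta> \<partial>lborel)"
    by (intro nn_integral_cong) (auto simp: indicator_def)
  finally show ?thesis .
qed

text \<open>
  The square on the right is what makes the Pareto law with exponent \<open>2 * \<alpha>\<close> the right one for the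
  Kendall kernel. For \<open>c < 1\<close> the integrand lives on \<open>[1, C]\<close> with \<open>c * C powr \<alpha> = 1\<close>, where
  \<open>2 * c * \<theta> powr (- \<alpha>) - \<theta> powr (- 2 * \<alpha>)\<close> is an antiderivative; it equals \<open>c\<^sup>2\<close> at \<open>C\<close> and
  \<open>2 * c - 1\<close> at \<open>1\<close>.
\<close>

lemma nn_integral_pareto_truncated_power:
  assumes "\<alpha> > 0" "c > 0"
  shows "(\<integral>\<^sup>+\<theta>. ennreal (max (1 - c * \<theta> powr \<alpha>) 0) \<partial>pareto (2 * \<alpha>)) = ennreal ((max (1 - c) 0)\<^sup>2)"
proof -
  have eq: "(\<integral>\<^sup>+\<theta>. ennreal (max (1 - c * \<theta> powr \<alpha>) 0) \<partial>pareto (2 * \<alpha>)) =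
      (\<integral>\<^sup>+\<theta>. ennreal (2 * \<alpha> / \<theta> powr (2 * \<alpha> + 1)) * ennreal (max (1 - c * \<theta> powr \<alpha>) 0)
        * indicator {1<..} \<theta> \<partial>lborel)"
    by (rule nn_integral_pareto) measurable
  show ?thesis
  proof (cases "c < 1")
    case False
    have zero: "ennreal (2 * \<alpha> / \<theta> powr (2 * \<alpha> + 1)) * ennreal (max (1 - c * \<theta> powr \<alpha>) 0)
        * indicator {1<..} \<theta> = 0" for \<theta>
    proof -
      have "1 \<le> c * \<theta> powr \<alpha>" if "\<theta> > 1"
        using that False assms mult_mono[of 1 c 1 "\<theta> powr \<alpha>"] ge_one_powr_ge_zero[of \<theta> \<alpha>] by auto
      thus ?thesis by (auto simp: indicator_def max_def)
    qed
    show ?thesis using False unfolding eq zero by (simp add: max_def)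
  next
    case True
    define C where "C = c powr (- 1 / \<alpha>)"
    have C: "C powr (- \<alpha>) = c" "C powr (- 2 * \<alpha>) = c\<^sup>2" "C > 0"
      using assms by (simp_all add: C_def powr_powr flip: powr_numeral)
    have "1 powr (- 1 / \<alpha>) \<le> c powr (- 1 / \<alpha>)"
      using assms True by (intro powr_mono2') auto
    hence C1: "1 \<le> C" by (simp add: C_def)
    have cut: "c * \<theta> powr \<alpha> \<le> 1 \<longleftrightarrow> \<theta> \<le> C" if "\<theta> > 0" for \<theta>
    proof -
      have "\<theta> \<le> C \<longleftrightarrow> \<theta> powr \<alpha> \<le> C powr \<alpha>"
        using that assms C by (metis less_imp_le linorder_not_le powr_less_mono2 powr_mono2)
      also have "C powr \<alpha> = 1 / c"
        using C(1) by (simp add: powr_minus_divide flip: C(1))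
      finally show ?thesis using assms by (simp add: field_simps)
    qed
    define g where "g = (\<lambda>\<theta>. 2 * \<alpha> / \<theta> powr (2 * \<alpha> + 1) * (1 - c * \<theta> powr \<alpha>))"
    have "(\<integral>\<^sup>+\<theta>. ennreal (2 * \<alpha> / \<theta> powr (2 * \<alpha> + 1)) * ennreal (max (1 - c * \<theta> powr \<alpha>) 0)
          * indicator {1<..} \<theta> \<partial>lborel) = (\<integral>\<^sup>+\<theta>. ennreal (g \<theta>) * indicator {1..C} \<theta> \<partial>lborel)"
    (* The Pareto density vanishes at 1, whereas [1, C] contains 1. *)
    proof (intro nn_integral_cong_AE, rule AE_mp[OF AE_lborel_singleton[of 1]], intro AE_I2 impI)
      fix \<theta> :: real assume "\<theta> \<noteq> 1"
      thus "ennreal (2 * \<alpha> / \<theta> powr (2 * \<alpha> + 1)) * ennreal (max (1 - c * \<theta> powr \<alpha>) 0)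
          * indicator {1<..} \<theta> = ennreal (g \<theta>) * indicator {1..C} \<theta>"
        using assms cut[of \<theta>]
        by (auto simp: indicator_def g_def max_def simp flip: ennreal_mult)
    qed
    also have "\<dots> = ennreal ((2 * c * C powr (- \<alpha>) - C powr (- 2 * \<alpha>)) -
        (2 * c * 1 powr (- \<alpha>) - 1 powr (- 2 * \<alpha>)))"
    proof (rule nn_integral_FTC_Icc[where F = "\<lambda>\<theta>. 2 * c * \<theta> powr (- \<alpha>) - \<theta> powr (- 2 * \<alpha>)"])
      show "((\<lambda>\<theta>. 2 * c * \<theta> powr (- \<alpha>) - \<theta> powr (- 2 * \<alpha>)) has_real_derivative g \<theta>)
          (at \<theta>)" if "\<theta> \<in> {1..C}" for \<theta>
      proof -
        have "\<theta> > 0" using that by simp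
        moreover have "- \<alpha> * \<theta> powr (- \<alpha> - 1) * (2 * c) - - 2 * \<alpha> * \<theta> powr (- 2 * \<alpha> - 1) = g \<theta>"
        proof -
          have "\<theta> powr (- 2 * \<alpha> - 1) = 1 / \<theta> powr (2 * \<alpha> + 1)"
            by (simp flip: powr_minus_divide)
          moreover have "\<theta> powr (- \<alpha> - 1) = \<theta> powr \<alpha> * \<theta> powr (- 2 * \<alpha> - 1)"
            by (simp flip: powr_add)
          ultimately show ?thesis by (simp add: g_def algebra_simps diff_divide_distrib)
        qed
        ultimately show ?thesis
          by (auto intro!: derivative_eq_intros)
      qed
      show "0 \<le> g \<theta>" if "\<theta> \<in> {1..C}" for \<theta>
        using that cut[of \<theta>] assms by (auto simp: g_def)
    qed (use C1 in \<open>auto simp: g_def\<close>)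
    also have "\<dots> = ennreal ((max (1 - c) 0)\<^sup>2)"
      using True unfolding C by (simp add: power2_eq_square algebra_simps)
    finally show ?thesis unfolding eq .
  qed
qed

section \<open>Multiplicativity of the homomorphism\<close>

lemma max_truncation_measurable:
  "(\<lambda>z. max (1 - (z * t) powr \<alpha>) 0) \<in> borel_measurable borel_nonneg"
  by (intro measurable_restrict_space1) measurable

text \<open>
  The case \<open>x = y = 0\<close> is trivial. For \<open>x \<le> y\<close> with \<open>y > 0\<close> put \<open>c = (y * t) powr \<alpha>\<close> and let \<open>p = x powr \<alpha> / y powr \<alpha>\<close> be the weight of the Pareto
  part, so that \<open>(x * t) powr \<alpha> = p * c\<close>. If \<open>c \<le> 1\<close>, the atom and the Pareto part contribute
  \<open>(1 - p) * (1 - c) + p * (1 - c)\<^sup>2\<close>, which factors as \<open>(1 - p * c) * (1 - c)\<close>; if \<open>c > 1\<close>, both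
  sides vanish.
\<close>

lemma nn_integral_kendall_kernel:
  assumes "\<alpha> > 0" "t > 0" "x \<ge> 0" "y \<ge> 0"
  shows "(\<integral>\<^sup>+z. ennreal (max (1 - (z * t) powr \<alpha>) 0) \<partial>kendall_kernel \<alpha> x y) =
    ennreal (max (1 - (x * t) powr \<alpha>) 0) * ennreal (max (1 - (y * t) powr \<alpha>) 0)"
proof -
  let ?h = "\<lambda>z. max (1 - (z * t) powr \<alpha>) 0"
  have ordered: "(\<integral>\<^sup>+z. ennreal (?h z) \<partial>kendall_kernel \<alpha> a b) = ennreal (?h a) * ennreal (?h b)"
    if ab: "0 \<le> a" "a \<le> b" for a b
  proof (cases "b = 0")
    case True
    hence a: "a = 0" using ab by simp
    have "(\<integral>\<^sup>+z. ennreal (?h z) \<partial>return borel_nonneg 0) = ennreal (?h 0)"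
      by (intro nn_integral_return measurable_compose[OF max_truncation_measurable measurable_ennreal])
         (simp add: space_restrict_space)
    thus ?thesis by (simp add: kendall_kernel_0 a True)
  next
    case False
    hence b: "b > 0" using ab by simp
    define p where "p = a powr \<alpha> / b powr \<alpha>"
    define c where "c = (b * t) powr \<alpha>"
    have p: "0 \<le> p" "p \<le> 1"
      using ab b assms by (auto simp: p_def divide_simps powr_mono2)
    have c: "c > 0" using b assms by (simp add: c_def)
    have pc: "(a * t) powr \<alpha> = p * c"
      using ab b assms by (simp add: p_def c_def powr_mult)
    have "(\<integral>\<^sup>+z. ennreal (?h z) \<partial>kendall_kernel \<alpha> a b) =
        ennreal (1 - p) * (\<integral>\<^sup>+z. ennreal (?h z) \<partial>return borel_nonneg b) +
        ennreal p * (\<integral>\<^sup>+z. ennreal (?h z) \<partial>rescale b (pareto (2 * \<alpha>)))"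
      unfolding p_def
      using ab b measurable_compose[OF max_truncation_measurable[of t \<alpha>] measurable_ennreal]
      by (intro nn_integral_emeasure_linear_combination)
         (auto simp: sets_kendall_kernel rescale_def emeasure_kendall_kernel cong: measurable_cong_sets)
    also have "(\<integral>\<^sup>+z. ennreal (?h z) \<partial>return borel_nonneg b) = ennreal (max (1 - c) 0)"
      unfolding c_def using b
      by (intro nn_integral_return measurable_compose[OF max_truncation_measurable measurable_ennreal])
         (simp add: space_restrict_space)
    also have "(\<integral>\<^sup>+z. ennreal (?h z) \<partial>rescale b (pareto (2 * \<alpha>))) =
        (\<integral>\<^sup>+\<theta>. ennreal (?h (b * \<theta>)) \<partial>pareto (2 * \<alpha>))"
      unfolding rescale_def
      using b measurable_compose[OF max_truncation_measurable[of t \<alpha>] measurable_ennreal]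
      by (intro nn_integral_distr rescale_pareto_measurable) auto
    also have "\<dots> = (\<integral>\<^sup>+\<theta>. ennreal (max (1 - c * \<theta> powr \<alpha>) 0) \<partial>pareto (2 * \<alpha>))"
      using b assms by (intro nn_integral_cong) (simp add: space_pareto c_def powr_mult mult_ac)
    also have "\<dots> = ennreal ((max (1 - c) 0)\<^sup>2)"
      by (rule nn_integral_pareto_truncated_power[OF assms(1) c])
    also have "ennreal (1 - p) * ennreal (max (1 - c) 0) + ennreal p * ennreal ((max (1 - c) 0)\<^sup>2) =
        ennreal ((1 - p) * max (1 - c) 0 + p * (max (1 - c) 0)\<^sup>2)"
      using p by (simp add: ennreal_mult ennreal_plus)
    also have "(1 - p) * max (1 - c) 0 + p * (max (1 - c) 0)\<^sup>2 = max (1 - p * c) 0 * max (1 - c) 0"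
    proof (cases "c \<le> 1")
      case True
      hence "p * c \<le> 1" using p c mult_mono[of p 1 c 1] by simp
      thus ?thesis using True by (simp add: max_def power2_eq_square algebra_simps)
    qed (simp add: max_def)
    finally show ?thesis by (simp add: pc c_def ennreal_mult)
  qed
  show ?thesis
    using ordered[of x y] ordered[of y x] assms
    by (cases "x \<le> y") (auto simp: kendall_kernel_commute[of \<alpha> x y] mult.commute)
qed

lemma integrable_truncation:
  assumes "\<mu> \<in> P_plus"
  shows "integrable \<mu> (\<lambda>x. max (1 - (x * t) powr \<alpha>) 0)"
proof -
  interpret prob_space \<mu> using assms by (rule P_plusD)
  have "(\<lambda>x. max (1 - (x * t) powr \<alpha>) 0) \<in> borel_measurable \<mu>"
    using max_truncation_measurable P_plusD(2)[OF assms] by (simp cong: measurable_cong_sets)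
  thus ?thesis by (rule integrable_const_bound[of _ 1, rotated]) auto
qed

lemma ennreal_Phi:
  assumes "\<mu> \<in> P_plus" "t \<ge> 0"
  shows "ennreal (Phi \<alpha> \<mu> t) = (\<integral>\<^sup>+x. ennreal (max (1 - (x * t) powr \<alpha>) 0) \<partial>\<mu>)"
  unfolding Phi_eq_integral[OF assms]
  by (intro nn_integral_eq_integral[symmetric] integrable_truncation assms) auto

lemma Phi_nonneg: "\<mu> \<in> P_plus \<Longrightarrow> t \<ge> 0 \<Longrightarrow> 0 \<le> Phi \<alpha> \<mu> t"
  by (simp add: Phi_eq_integral)

lemma Phi_kendall_conv:
  assumes "\<alpha> > 0" "t > 0" and \<mu>: "\<mu> \<in> P_plus" and \<nu>: "\<nu> \<in> P_plus"
  shows "Phi \<alpha> (kendall_conv \<alpha> \<mu> \<nu>) t = Phi \<alpha> \<mu> t * Phi \<alpha> \<nu> t"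
proof -
  let ?h = "\<lambda>z. ennreal (max (1 - (z * t) powr \<alpha>) 0)"
  have h: "?h \<in> borel_measurable borel_nonneg"
    using max_truncation_measurable by measurable
  have sets [measurable_cong]: "sets \<mu> = sets borel_nonneg" "sets \<nu> = sets borel_nonneg"
    using \<mu> \<nu> by (auto simp: P_plusD)
  have inner: "(\<lambda>x. \<nu> \<bind> (\<lambda>y. kendall_kernel \<alpha> x y)) \<in> measurable \<mu> (subprob_algebra borel_nonneg)"
    using assms measurable_kendall_kernel[of \<alpha>]
    by (intro measurable_prob_algebraD measurable_bind_prob_space2[where N = borel_nonneg] measurable_const)
       (auto simp: P_plus_def sets cong: measurable_cong_sets)
  have kernel: "(\<lambda>y. kendall_kernel \<alpha> x y) \<in> measurable \<nu> (subprob_algebra borel_nonneg)" if "x \<ge> 0" for x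
    using measurable_prob_algebraD[OF measurable_compose[OF measurable_Pair1'[of x borel_nonneg borel_nonneg]
        measurable_kendall_kernel[OF assms(1)]]] that
    by (simp add: space_restrict_space sets cong: measurable_cong_sets)
  have "ennreal (Phi \<alpha> (kendall_conv \<alpha> \<mu> \<nu>) t) = (\<integral>\<^sup>+z. ?h z \<partial>kendall_conv \<alpha> \<mu> \<nu>)"
    using assms by (intro ennreal_Phi kendall_conv_P_plus) auto
  also have "\<dots> = (\<integral>\<^sup>+x. \<integral>\<^sup>+z. ?h z \<partial>(\<nu> \<bind> (\<lambda>y. kendall_kernel \<alpha> x y)) \<partial>\<mu>)"
    unfolding kendall_conv_def by (rule nn_integral_bind[OF h inner])
  also have "\<dots> = (\<integral>\<^sup>+x. \<integral>\<^sup>+y. ?h x * ?h y \<partial>\<nu> \<partial>\<mu>)"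
  proof (rule nn_integral_cong)
    fix x assume "x \<in> space \<mu>"
    hence x: "x \<ge> 0" using P_plusD[OF \<mu>] by simp
    have "(\<integral>\<^sup>+z. ?h z \<partial>(\<nu> \<bind> (\<lambda>y. kendall_kernel \<alpha> x y))) = (\<integral>\<^sup>+y. \<integral>\<^sup>+z. ?h z \<partial>kendall_kernel \<alpha> x y \<partial>\<nu>)"
      by (rule nn_integral_bind[OF h kernel[OF x]])
    also have "\<dots> = (\<integral>\<^sup>+y. ?h x * ?h y \<partial>\<nu>)"
      using assms x P_plusD[OF \<nu>] by (intro nn_integral_cong nn_integral_kendall_kernel) auto
    finally show "(\<integral>\<^sup>+z. ?h z \<partial>(\<nu> \<bind> (\<lambda>y. kendall_kernel \<alpha> x y))) = (\<integral>\<^sup>+y. ?h x * ?h y \<partial>\<nu>)" .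
  qed
  also have "\<dots> = (\<integral>\<^sup>+x. ?h x \<partial>\<mu>) * (\<integral>\<^sup>+y. ?h y \<partial>\<nu>)"
    using h by (simp add: nn_integral_cmult nn_integral_multc sets cong: measurable_cong_sets)
  also have "\<dots> = ennreal (Phi \<alpha> \<mu> t * Phi \<alpha> \<nu> t)"
    using assms Phi_nonneg[OF \<mu>, of t] Phi_nonneg[OF \<nu>, of t]
    by (simp only: ennreal_Phi[symmetric] ennreal_mult less_imp_le)
  finally show ?thesis
    using assms by (simp add: Phi_nonneg kendall_conv_P_plus)
qed

lemma Phi_kendall_power:
  assumes "\<alpha> > 0" "t > 0" "\<nu> \<in> P_plus"
  shows "Phi \<alpha> (kendall_power \<alpha> \<nu> n) t = Phi \<alpha> \<nu> t ^ n"
proof (induction n)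
  case 0
  have "Phi \<alpha> (kendall_power \<alpha> \<nu> 0) t = (LINT x|return borel_nonneg 0. max (1 - (x * t) powr \<alpha>) 0)"
    using kendall_power_P_plus[OF assms(1,3), of 0] assms by (simp add: Phi_eq_integral)
  also have "\<dots> = 1"
    using max_truncation_measurable by (subst integral_return) (auto simp: space_restrict_space)
  finally show ?case by simp
next
  case (Suc n)
  thus ?case using assms by (simp add: Phi_kendall_conv kendall_power_P_plus)
qed

text \<open>
  As \<open>t\<close> grows, the integrand \<open>max (1 - (x * t) powr \<alpha>) 0\<close> stays \<open>1\<close> at \<open>x = 0\<close> and is eventually \<open>0\<close>
  everywhere else.
\<close>

lemma Phi_tendsto_measure_0:
  assumes "\<alpha> > 0" "\<mu> \<in> P_plus"
  shows "(\<lambda>k. Phi \<alpha> \<mu> (real k)) \<longlonglongrightarrow> measure \<mu> {0}"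
proof -
  interpret prob_space \<mu> using assms(2) by (rule P_plusD)
  have 0: "{0} \<in> sets \<mu>"
    using P_plusD[OF assms(2)] by (auto simp: sets_restrict_space intro!: image_eqI[of _ _ "{0}"])
  have "(\<lambda>k. LINT x|\<mu>. max (1 - (x * real k) powr \<alpha>) 0) \<longlonglongrightarrow> (LINT x|\<mu>. indicator {0} x)"
  proof (rule integral_dominated_convergence[where w = "\<lambda>_. 1"])
    show "AE x in \<mu>. (\<lambda>k. max (1 - (x * real k) powr \<alpha>) 0) \<longlonglongrightarrow> indicator {0} x"
    proof (rule AE_I2)
      fix x assume "x \<in> space \<mu>"
      hence x: "x \<ge> 0" using P_plusD[OF assms(2)] by simp
      show "(\<lambda>k. max (1 - (x * real k) powr \<alpha>) 0) \<longlonglongrightarrow> indicator {0} x"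
      proof (cases "x = 0")
        case False
        have "\<forall>\<^sub>F k in sequentially. 1 / x \<le> real k"
          using filterlim_real_sequentially by (simp add: filterlim_at_top)
        hence "\<forall>\<^sub>F k in sequentially. max (1 - (x * real k) powr \<alpha>) 0 = 0"
        proof eventually_elim
          case (elim k)
          hence "1 \<le> x * real k" using x False by (simp add: field_simps)
          thus ?case using assms ge_one_powr_ge_zero[of "x * real k" \<alpha>] by simp
        qed
        thus ?thesis using False by (simp add: tendsto_eventually)
      qed simp
    qed
  qed (use 0 in \<open>auto intro: borel_measurable_integrable integrable_truncation[OF assms(2)]\<close>)
  moreover have "(LINT x|\<mu>. indicator {0} x) = measure \<mu> {0}"
    using 0 sets.sets_into_space[OF 0] by (simp add: Int_absorb2)
  ultimately show ?thesis using assms by (simp add: Phi_eq_integral)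
qed

text \<open>
  The atom at the origin is a limit of values of \<open>Phi\<close>, and hence inherits multiplicativity
  from it.
\<close>

lemma measure_kendall_power_0:
  assumes "\<alpha> > 0" "\<nu> \<in> P_plus"
  shows "measure (kendall_power \<alpha> \<nu> n) {0} = measure \<nu> {0} ^ n"
proof (rule LIMSEQ_unique)
  show "(\<lambda>k. Phi \<alpha> (kendall_power \<alpha> \<nu> n) (real k)) \<longlonglongrightarrow> measure (kendall_power \<alpha> \<nu> n) {0}"
    using assms by (intro Phi_tendsto_measure_0 kendall_power_P_plus)
  have "(\<lambda>k. Phi \<alpha> \<nu> (real k) ^ n) \<longlonglongrightarrow> measure \<nu> {0} ^ n"
    using assms by (intro tendsto_power Phi_tendsto_measure_0)
  moreover have "\<forall>\<^sub>F k in sequentially. Phi \<alpha> \<nu> (real k) ^ n = Phi \<alpha> (kendall_power \<alpha> \<nu> n) (real k)"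
    using eventually_gt_at_top[of 0] by eventually_elim (simp add: Phi_kendall_power assms)
  ultimately show "(\<lambda>k. Phi \<alpha> (kendall_power \<alpha> \<nu> n) (real k)) \<longlonglongrightarrow> measure \<nu> {0} ^ n"
    by (rule Lim_transform_eventually)
qed

section \<open>Derivatives of integrated distribution functions\<close>

text \<open>
  The increment \<open>max (v - x) 0 - max (u - x) 0\<close> is \<open>v - u\<close> for \<open>x \<le> u\<close>, vanishes for \<open>x \<ge> v\<close> and
  lies in between otherwise. Bounding it by multiples of indicators of \<open>{..u}\<close> and
  \<open>{..<v}\<close>, rather than using \<open>cdf M v\<close> on the right, makes the bounds sharp enough
  to separate the two one-sided derivatives at an atom.
\<close>

lemma (in finite_borel_measure) integral_positive_part_slope_bounds:
  assumes int: "\<And>s. integrable M (\<lambda>x. max (s - x) 0)" and "u < v"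
  shows "cdf M u \<le> ((LINT x|M. max (v - x) 0) - (LINT x|M. max (u - x) 0)) / (v - u)"
    and "((LINT x|M. max (v - x) 0) - (LINT x|M. max (u - x) 0)) / (v - u) \<le> measure M {..<v}"
proof -
  have space: "space M = UNIV"
    using sets_eq_imp_space_eq[OF M_is_borel] by simp
  have diff: "(LINT x|M. max (v - x) 0) - (LINT x|M. max (u - x) 0) =
      (LINT x|M. max (v - x) 0 - max (u - x) 0)"
    using int by simp
  have ind: "integrable M (indicator A :: real \<Rightarrow> real)" if "A \<in> sets borel" for A
    using that by (intro integrable_real_indicator) (auto simp: less_top[symmetric])
  have "cdf M u = (LINT x|M. indicator {..u} x)" "measure M {..<v} = (LINT x|M. indicator {..<v} x)"
    by (simp_all add: cdf_def space)
  moreover have "(v - u) * (LINT x|M. indicator {..u} x) \<le> (LINT x|M. max (v - x) 0 - max (u - x) 0)"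
    unfolding integral_mult_right_zero[symmetric] using \<open>u < v\<close>
    by (intro integral_mono integrable_mult_right ind Bochner_Integration.integrable_diff int)
       (auto simp: indicator_def)
  moreover have "(LINT x|M. max (v - x) 0 - max (u - x) 0) \<le> (v - u) * (LINT x|M. indicator {..<v} x)"
    unfolding integral_mult_right_zero[symmetric] using \<open>u < v\<close>
    by (intro integral_mono integrable_mult_right ind Bochner_Integration.integrable_diff int)
       (auto simp: indicator_def)
  ultimately show "cdf M u \<le> ((LINT x|M. max (v - x) 0) - (LINT x|M. max (u - x) 0)) / (v - u)"
    and "((LINT x|M. max (v - x) 0) - (LINT x|M. max (u - x) 0)) / (v - u) \<le> measure M {..<v}"
    unfolding diff using \<open>u < v\<close> by (simp_all add: pos_le_divide_eq pos_divide_le_eq mult.commute)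
qed

text \<open>
  This and the next lemma reflect that \<open>\<integral> max (s - x) 0 dM(x)\<close> is the integral of the distribution
  function of \<open>M\<close> up to \<open>s\<close>. As slopes are squeezed between values of that function, its
  one-sided limits at \<open>s\<close> give the one-sided derivatives.
\<close>

lemma (in finite_borel_measure) integral_positive_part_has_left_derivative:
  assumes int: "\<And>s. integrable M (\<lambda>x. max (s - x) 0)"
  shows "((\<lambda>s. LINT x|M. max (s - x) 0) has_real_derivative measure M {..<s}) (at_left s)"
  unfolding has_field_derivative_iff
proof (rule tendsto_sandwich[OF _ _ cdf_at_left tendsto_const])
  show "\<forall>\<^sub>F u in at_left s. cdf M u \<le>
      ((LINT x|M. max (u - x) 0) - (LINT x|M. max (s - x) 0)) / (u - s)"
    unfolding eventually_at_filter
  proof (intro always_eventually allI impI)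
    fix u :: real assume "u \<noteq> s" "u \<in> {..<s}"
    thus "cdf M u \<le> ((LINT x|M. max (u - x) 0) - (LINT x|M. max (s - x) 0)) / (u - s)"
      using integral_positive_part_slope_bounds(1)[OF int, of u s] by (simp add: divide_simps split: if_splits) argo
  qed
  show "\<forall>\<^sub>F u in at_left s. ((LINT x|M. max (u - x) 0) - (LINT x|M. max (s - x) 0)) / (u - s)
      \<le> measure M {..<s}"
    unfolding eventually_at_filter
  proof (intro always_eventually allI impI)
    fix u :: real assume "u \<noteq> s" "u \<in> {..<s}"
    thus "((LINT x|M. max (u - x) 0) - (LINT x|M. max (s - x) 0)) / (u - s) \<le> measure M {..<s}"
      using integral_positive_part_slope_bounds(2)[OF int, of u s] by (simp add: divide_simps split: if_splits) argo
  qed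
qed

lemma (in finite_borel_measure) integral_positive_part_has_right_derivative:
  assumes int: "\<And>s. integrable M (\<lambda>x. max (s - x) 0)"
  shows "((\<lambda>s. LINT x|M. max (s - x) 0) has_real_derivative measure M {..s}) (at_right s)"
  unfolding has_field_derivative_iff
proof (rule tendsto_sandwich[OF _ _ tendsto_const])
  show "(cdf M \<longlongrightarrow> measure M {..s}) (at_right s)"
    using cdf_is_right_cont[of s] by (simp add: continuous_within cdf_def)
  show "\<forall>\<^sub>F u in at_right s. measure M {..s} \<le>
      ((LINT x|M. max (u - x) 0) - (LINT x|M. max (s - x) 0)) / (u - s)"
    unfolding eventually_at_filter
    using integral_positive_part_slope_bounds(1)[OF int, of s]
    by (intro always_eventually) (auto simp: cdf_def)
  show "\<forall>\<^sub>F u in at_right s. ((LINT x|M. max (u - x) 0) - (LINT x|M. max (s - x) 0)) / (u - s)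
      \<le> cdf M u"
    unfolding eventually_at_filter
  proof (intro always_eventually allI impI)
    fix u :: real assume "u \<noteq> s" "u \<in> {s<..}"
    moreover have "measure M {..<u} \<le> cdf M u"
      unfolding cdf_def by (intro finite_measure_mono) (auto simp: M_is_borel)
    ultimately show "((LINT x|M. max (u - x) 0) - (LINT x|M. max (s - x) 0)) / (u - s) \<le> cdf M u"
      using integral_positive_part_slope_bounds(2)[OF int, of s u] by auto
  qed
qed

text \<open>
  Passage between the two forms of the inversion formula, by writing \<open>g (1 / u)\<close> as \<open>F s / s\<close>
  with \<open>s = u powr \<alpha>\<close> and \<open>F s = s * g (s powr (- 1 / \<alpha>))\<close>. The sets \<open>S\<close> and \<open>T\<close> allow one-sided as
  well as two-sided derivatives.
\<close>

lemma has_real_derivative_inverse_power_substitution: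
  fixes g :: "real \<Rightarrow> real"
  assumes "x > 0" "\<alpha> > 0"
    and D: "((\<lambda>s. s * g (s powr (- 1 / \<alpha>))) has_real_derivative D) (at (x powr \<alpha>) within S)"
    and S: "\<And>u. u \<in> T \<Longrightarrow> u > 0 \<Longrightarrow> u powr \<alpha> \<in> S"
  shows "((\<lambda>u. g (1 / u)) has_real_derivative \<alpha> / x * (D - g (1 / x))) (at x within T)"
proof -
  (* u is recovered from u powr \<alpha> only for u > 0; near x this loses nothing. *)
  define T' where "T' = T \<inter> {0<..}"
  have at: "at x within T = at x within T'"
    unfolding T'_def using assms(1) by (intro at_within_nhd[of x "{0<..}"]) auto
  have powr_g: "(u powr \<alpha>) powr (- 1 / \<alpha>) = 1 / u" if "u > 0" for u
    using that assms(2) by (simp add: powr_powr powr_minus_divide)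
  have pow: "((\<lambda>u. u powr \<alpha>) has_real_derivative \<alpha> * x powr (\<alpha> - 1)) (at x within T')"
    using assms by (auto intro!: derivative_eq_intros simp: powr_diff)
  have "((\<lambda>s. s * g (s powr (- 1 / \<alpha>))) has_real_derivative D) (at (x powr \<alpha>) within (\<lambda>u. u powr \<alpha>) ` T')"
    using D by (rule DERIV_subset) (auto simp: T'_def S)
  from DERIV_image_chain[OF this pow]
  have "((\<lambda>u. u powr \<alpha> * g ((u powr \<alpha>) powr (- 1 / \<alpha>))) has_real_derivative
      D * (\<alpha> * x powr (\<alpha> - 1))) (at x within T')" by (simp add: o_def)
  from DERIV_divide[OF this pow]
  have "((\<lambda>u. u powr \<alpha> * g ((u powr \<alpha>) powr (- 1 / \<alpha>)) / u powr \<alpha>) has_real_derivative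
      (D * (\<alpha> * x powr (\<alpha> - 1)) * x powr \<alpha> - x powr \<alpha> * g (1 / x) * (\<alpha> * x powr (\<alpha> - 1)))
        / (x powr \<alpha> * x powr \<alpha>)) (at x within T')"
    using assms(1) by (simp add: powr_g[simplified])
  moreover have "(D * (\<alpha> * x powr (\<alpha> - 1)) * x powr \<alpha> - x powr \<alpha> * g (1 / x) * (\<alpha> * x powr (\<alpha> - 1)))
        / (x powr \<alpha> * x powr \<alpha>) = \<alpha> / x * (D - g (1 / x))"
    using assms(1) by (simp add: powr_diff field_simps)
  ultimately have "((\<lambda>u. u powr \<alpha> * g ((u powr \<alpha>) powr (- 1 / \<alpha>)) / u powr \<alpha>) has_real_derivative
      \<alpha> / x * (D - g (1 / x))) (at x within T')" by simp
  moreover have "\<forall>\<^sub>F u in at x within T'. u powr \<alpha> * g ((u powr \<alpha>) powr (- 1 / \<alpha>)) / u powr \<alpha> = g (1 / u)"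
    unfolding eventually_at_filter T'_def
    by (intro always_eventually) (auto simp: powr_g[simplified])
  ultimately show ?thesis
    unfolding at using assms(1)
    by (subst (asm) has_field_derivative_cong_eventually) (auto simp: powr_g[simplified])
qed

section \<open>Inversion of the homomorphism\<close>

text \<open>
  Since \<open>s * max (1 - y powr \<alpha> / s) 0 = max (s - y powr \<alpha>) 0\<close> for \<open>s > 0\<close>, the function
  \<open>s * Phi \<alpha> \<mu> (s powr (- 1 / \<alpha>))\<close> is the integral of \<open>max (s - z) 0\<close> against the image \<open>M\<close> of \<open>\<mu>\<close>
  under \<open>y \<mapsto> y powr \<alpha>\<close>, whose one-sided derivatives are known.
\<close>

lemma scaled_Phi_one_sided_derivatives:
  assumes "\<alpha> > 0" "x > 0" and \<mu>: "\<mu> \<in> P_plus"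
  shows "((\<lambda>s. s * Phi \<alpha> \<mu> (s powr (- 1 / \<alpha>))) has_real_derivative measure \<mu> {0..<x})
      (at_left (x powr \<alpha>))"
    and "((\<lambda>s. s * Phi \<alpha> \<mu> (s powr (- 1 / \<alpha>))) has_real_derivative measure \<mu> {0..x})
      (at_right (x powr \<alpha>))"
proof -
  interpret \<mu>: prob_space \<mu> using \<mu> by (rule P_plusD)
  note sp = P_plusD(3)[OF \<mu>]
  have m [measurable]: "(\<lambda>y. y powr \<alpha>) \<in> borel_measurable \<mu>"
    using measurable_restrict_space1[of "\<lambda>y::real. y powr \<alpha>" borel borel "{0..}"] P_plusD(2)[OF \<mu>]
    by (simp cong: measurable_cong_sets)
  define M where "M = distr \<mu> borel (\<lambda>y. y powr \<alpha>)"
  interpret M: finite_borel_measure M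
    unfolding M_def finite_borel_measure_def finite_borel_measure_axioms_def
    by (auto intro: \<mu>.finite_measure_distr)
  have int: "integrable M (\<lambda>y. max (s - y) 0)" for s
  proof -
    have "integrable \<mu> (\<lambda>y. max (s - y powr \<alpha>) 0)"
    proof (rule \<mu>.integrable_const_bound[of _ "\<bar>s\<bar>"])
      show "AE y in \<mu>. norm (max (s - y powr \<alpha>) 0) \<le> \<bar>s\<bar>"
      proof (rule AE_I2)
        fix y
        have "s - y powr \<alpha> \<le> \<bar>s\<bar>"
          using powr_ge_zero[of y \<alpha>] by linarith
        thus "norm (max (s - y powr \<alpha>) 0) \<le> \<bar>s\<bar>"
          by simp
      qed
    qed simp
    thus ?thesis by (simp add: M_def integrable_distr_eq)
  qed
  have eq: "(LINT y|M. max (s - y) 0) = s * Phi \<alpha> \<mu> (s powr (- 1 / \<alpha>))" if "s > 0" for s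
  proof -
    have "(LINT y|M. max (s - y) 0) = (LINT y|\<mu>. max (s - y powr \<alpha>) 0)"
      by (simp add: M_def integral_distr)
    also have "\<dots> = (LINT y|\<mu>. s * max (1 - (y * s powr (- 1 / \<alpha>)) powr \<alpha>) 0)"
    proof (rule Bochner_Integration.integral_cong[OF refl])
      fix y assume "y \<in> space \<mu>"
      hence level: "(y * s powr (- 1 / \<alpha>)) powr \<alpha> = y powr \<alpha> / s"
        using that assms sp by (simp add: powr_mult powr_divide powr_powr powr_minus_divide)
      show "max (s - y powr \<alpha>) 0 = s * max (1 - (y * s powr (- 1 / \<alpha>)) powr \<alpha>) 0"
        unfolding level using that by (auto simp: max_def divide_le_eq right_diff_distrib)
    qed
    also have "\<dots> = s * Phi \<alpha> \<mu> (s powr (- 1 / \<alpha>))"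
      by (simp add: Phi_eq_integral[OF \<mu>])
    finally show ?thesis .
  qed
  have pos: "x powr \<alpha> > 0" using assms by simp
  have near: "\<forall>\<^sub>F s in at (x powr \<alpha>) within S. (LINT y|M. max (s - y) 0) = s * Phi \<alpha> \<mu> (s powr (- 1 / \<alpha>))" for S
  proof -
    have "\<forall>\<^sub>F s in nhds (x powr \<alpha>). s > 0"
      using eventually_nhds_in_open[of "{0<..}" "x powr \<alpha>"] pos by simp
    thus ?thesis
      unfolding eventually_at_filter by eventually_elim (simp add: eq)
  qed
  have level: "y powr \<alpha> < x powr \<alpha> \<longleftrightarrow> y < x" if "y \<ge> 0" for y
    using that assms by (metis less_imp_le linorder_not_le powr_less_mono2 powr_mono2)
  have level': "y powr \<alpha> \<le> x powr \<alpha> \<longleftrightarrow> y \<le> x" if "y \<ge> 0" for y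
    using that assms by (metis less_imp_le linorder_not_le powr_less_mono2 powr_mono2)
  have "(\<lambda>y. y powr \<alpha>) -` {..<x powr \<alpha>} \<inter> space \<mu> = {0..<x}"
    unfolding sp by (auto simp: level)
  hence "measure M {..<x powr \<alpha>} = measure \<mu> {0..<x}"
    by (simp add: M_def measure_distr)
  thus "((\<lambda>s. s * Phi \<alpha> \<mu> (s powr (- 1 / \<alpha>))) has_real_derivative measure \<mu> {0..<x})
      (at_left (x powr \<alpha>))"
    using M.integral_positive_part_has_left_derivative[OF int, of "x powr \<alpha>"]
    by (subst (asm) has_field_derivative_cong_eventually[OF near eq[OF pos]]) simp
  have "(\<lambda>y. y powr \<alpha>) -` {..x powr \<alpha>} \<inter> space \<mu> = {0..x}"
    unfolding sp by (auto simp: level')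
  hence "measure M {..x powr \<alpha>} = measure \<mu> {0..x}"
    by (simp add: M_def measure_distr)
  thus "((\<lambda>s. s * Phi \<alpha> \<mu> (s powr (- 1 / \<alpha>))) has_real_derivative measure \<mu> {0..x})
      (at_right (x powr \<alpha>))"
    using M.integral_positive_part_has_right_derivative[OF int, of "x powr \<alpha>"]
    by (subst (asm) has_field_derivative_cong_eventually[OF near eq[OF pos]]) simp
qed

lemma borel_subset_in_sets_P_plus:
  assumes "\<mu> \<in> P_plus" "A \<in> sets borel" "A \<subseteq> {0..}"
  shows "A \<in> sets \<mu>"
  using assms P_plusD(2)[OF assms(1)] by (simp add: sets_restrict_space_iff)

theorem proposition3p1:
  fixes \<nu> :: "real measure" and n :: nat and \<alpha> x :: real
  assumes "\<nu> \<in> P_plus" and "n \<ge> 2" and "\<alpha> > 0" and "x > 0"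
  shows
    "(\<exists>D. ((\<lambda>u. Phi \<alpha> \<nu> (1 / u) ^ n) has_real_derivative D) (at_left x) \<and>
        measure (kendall_power \<alpha> \<nu> n) {0..<x} = Phi \<alpha> \<nu> (1 / x) ^ n + inverse \<alpha> * x * D) \<and>
     (\<exists>D. ((\<lambda>s. s * Phi \<alpha> \<nu> (s powr (- 1 / \<alpha>)) ^ n) has_real_derivative D) (at_left (x powr \<alpha>)) \<and>
        measure (kendall_power \<alpha> \<nu> n) {0..<x} = D) \<and>
     (measure (kendall_power \<alpha> \<nu> n) {x} = 0 \<longrightarrow>
        (\<lambda>u. Phi \<alpha> \<nu> (1 / u) ^ n) differentiable (at x) \<and>
        measure (kendall_power \<alpha> \<nu> n) {0..<x} =
          Phi \<alpha> \<nu> (1 / x) ^ n + inverse \<alpha> * x * deriv (\<lambda>u. Phi \<alpha> \<nu> (1 / u) ^ n) x \<and>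
        (\<lambda>s. s * Phi \<alpha> \<nu> (s powr (- 1 / \<alpha>)) ^ n) differentiable (at (x powr \<alpha>)) \<and>
        measure (kendall_power \<alpha> \<nu> n) {0..<x} =
          deriv (\<lambda>s. s * Phi \<alpha> \<nu> (s powr (- 1 / \<alpha>)) ^ n) (x powr \<alpha>)) \<and>
     measure (kendall_power \<alpha> \<nu> n) {0..<x} =
       measure (kendall_power \<alpha> \<nu> n) {0<..<x} + measure \<nu> {0} ^ n"
proof -
  define P where "P = kendall_power \<alpha> \<nu> n"
  have P: "P \<in> P_plus" unfolding P_def using assms by (intro kendall_power_P_plus)
  interpret P: prob_space P using P by (rule P_plusD)
  let ?F = "\<lambda>s. s * Phi \<alpha> \<nu> (s powr (- 1 / \<alpha>)) ^ n"
  let ?G = "\<lambda>u. Phi \<alpha> \<nu> (1 / u) ^ n"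
  let ?m = "measure P {0..<x}"
  (* Multiplicativity of Phi replaces the power of \<nu> by the power of Phi. *)
  have Fx: "(?F has_real_derivative D) (at (x powr \<alpha>) within S)"
    if "((\<lambda>s. s * Phi \<alpha> P (s powr (- 1 / \<alpha>))) has_real_derivative D) (at (x powr \<alpha>) within S)" for D S
  proof -
    have eq: "Phi \<alpha> P (s powr (- 1 / \<alpha>)) = Phi \<alpha> \<nu> (s powr (- 1 / \<alpha>)) ^ n" if "s \<noteq> 0" for s
      using that assms by (simp add: P_def Phi_kendall_power)
    have "\<forall>\<^sub>F s in nhds (x powr \<alpha>). s \<noteq> 0"
      using eventually_nhds_in_open[of "- {0}" "x powr \<alpha>"] assms by (simp add: open_Compl)
    hence "\<forall>\<^sub>F s in at (x powr \<alpha>) within S. s * Phi \<alpha> P (s powr (- 1 / \<alpha>)) = ?F s"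
      unfolding eventually_at_filter by eventually_elim (auto simp: eq[simplified])
    from has_field_derivative_cong_eventually[OF this] that assms show ?thesis
      by (simp add: eq[simplified])
  qed
  have left: "(?F has_real_derivative ?m) (at_left (x powr \<alpha>))"
    using assms P by (intro Fx scaled_Phi_one_sided_derivatives)
  have left': "(?G has_real_derivative \<alpha> / x * (?m - ?G x)) (at_left x)"
    by (rule has_real_derivative_inverse_power_substitution[where g = "\<lambda>t. Phi \<alpha> \<nu> t ^ n",
          OF assms(4,3) left]) (use assms in \<open>auto intro: powr_less_mono2\<close>)
  have solve: "?m = ?G x + inverse \<alpha> * x * (\<alpha> / x * (?m - ?G x))"
    using assms by (simp add: field_simps)
  (* Without an atom at x, the left and the right derivative coincide. *)
  have two_sided: "(?F has_real_derivative ?m) (at (x powr \<alpha>))" if "measure P {x} = 0"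
  proof -
    have "measure P ({0..<x} \<union> {x}) = ?m + measure P {x}"
      using assms by (intro P.finite_measure_Union borel_subset_in_sets_P_plus[OF P]) auto
    moreover have "{0..<x} \<union> {x} = {0..x}" using assms by auto
    ultimately have "measure P {0..x} = ?m + measure P {x}" by simp
    with that have "(?F has_real_derivative ?m) (at_right (x powr \<alpha>))"
      using scaled_Phi_one_sided_derivatives(2)[OF assms(3,4) P] by (intro Fx) simp
    with left show ?thesis
      unfolding has_field_derivative_iff by (rule filterlim_split_at)
  qed
  have two_sided': "(?G has_real_derivative \<alpha> / x * (?m - ?G x)) (at x)" if "measure P {x} = 0"
    using has_real_derivative_inverse_power_substitution[where g = "\<lambda>t. Phi \<alpha> \<nu> t ^ n" and T = UNIV,
      OF assms(4,3) two_sided[OF that]] by simp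
  have "measure P ({0<..<x} \<union> {0}) = measure P {0<..<x} + measure P {0}"
    by (intro P.finite_measure_Union borel_subset_in_sets_P_plus[OF P]) auto
  moreover have "{0<..<x} \<union> {0} = {0..<x}" using assms by auto
  ultimately have "?m = measure P {0<..<x} + measure P {0}" by simp
  hence atom: "?m = measure P {0<..<x} + measure \<nu> {0} ^ n"
    using assms by (simp add: P_def measure_kendall_power_0)
  show ?thesis
    unfolding P_def[symmetric]
  proof (intro conjI impI)
    show "\<exists>D. (?G has_real_derivative D) (at_left x) \<and> ?m = ?G x + inverse \<alpha> * x * D"
      using left' solve by blast
    show "\<exists>D. (?F has_real_derivative D) (at_left (x powr \<alpha>)) \<and> ?m = D"
      using left by blast
    show "?m = measure P {0<..<x} + measure \<nu> {0} ^ n" by (rule atom)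
  next
    assume "measure P {x} = 0"
    note F = two_sided[OF this] and G = two_sided'[OF this]
    show "?G differentiable (at x)" "?F differentiable (at (x powr \<alpha>))"
      using F G by (auto simp: real_differentiable_def)
    show "?m = ?G x + inverse \<alpha> * x * deriv ?G x"
      unfolding DERIV_imp_deriv[OF G] by (rule solve)
    show "?m = deriv ?F (x powr \<alpha>)"
      by (rule DERIV_imp_deriv[OF F, symmetric])
  qed
qed

end
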